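(* Let $F\colon\mathcal C\rightleftarrows\mathcal D:U$ be a strong monoidal adjunction (left adjoint $F$ strong symmetric monoidal) between symmetric monoidal categories, and let $\theta\colon S\to R$ be a map of monoids in $\mathcal C$. Write $\phi=F\theta\colon FS\to FR$. Then there are natural isomorphisms $$\theta^*U\cong U\phi^*\colon \mathrm{Mod}_{FR}(\mathcal D)\to\mathrm{Mod}_S(\mathcal C)\qquad\text{and}\qquad F\theta^*\cong\phi^*F\colon\mathrm{Mod}_R(\mathcal C)\to\mathrm{Mod}_{FS}(\mathcal D).$$
   Context: $\mathrm{Mod}_S(\mathcal C)$ is the category of left $S$-modules in $\mathcal C$; $\theta^*$ and $\phi^*$ denote restriction of scalars along $\theta$ and $\phi$. Since $F$ is strong monoidal, it sends monoids to monoids and $S$-modules to $FS$-modules; $U$ is lax monoidal and, for an $FS$-module $N$, $UN$ is an $S$-module via the unit $S\to UFS$ and the lax structure map. The functors $F$ and $U$ above are these induced functors on module categories, for $S$ and for $R$. *)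

theory Defs
  imports Main
begin

section \<open>Categories, functors, natural isomorphisms\<close>

text \<open>
  As in HOL-Algebra, structures are records with explicit carriers, and all axioms are relativised
  to those carriers. Composition \<open>g \<cdot>\<^bsub>C\<^esub> f\<close> means ``first \<open>f\<close>, then \<open>g\<close>''.
\<close>

record ('o, 'm) category_data =
  Obj :: "'o set"
  Arr :: "'m set"
  Dom :: "'m \<Rightarrow> 'o"
  Cod :: "'m \<Rightarrow> 'o"
  Ident :: "'o \<Rightarrow> 'm"
  Comp :: "'m \<Rightarrow> 'm \<Rightarrow> 'm"  (infixr "\<cdot>\<index>" 70)

definition Hom :: "('o, 'm, 'z) category_data_scheme \<Rightarrow> 'o \<Rightarrow> 'o \<Rightarrow> 'm set" where
  "Hom C a b = {f \<in> Arr C. Dom C f = a \<and> Cod C f = b}"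

locale category =
  fixes C :: "('o, 'm, 'z) category_data_scheme" (structure)
  assumes Dom_in_Obj: "f \<in> Arr C \<Longrightarrow> Dom C f \<in> Obj C"
    and Cod_in_Obj: "f \<in> Arr C \<Longrightarrow> Cod C f \<in> Obj C"
    and Ident_in_Hom: "a \<in> Obj C \<Longrightarrow> Ident C a \<in> Hom C a a"
    and Comp_in_Hom: "f \<in> Hom C a b \<Longrightarrow> g \<in> Hom C b c \<Longrightarrow> g \<cdot> f \<in> Hom C a c"
    and Comp_Ident: "f \<in> Hom C a b \<Longrightarrow> f \<cdot> Ident C a = f"
    and Ident_Comp: "f \<in> Hom C a b \<Longrightarrow> Ident C b \<cdot> f = f"
    and Comp_assoc:
      "f \<in> Hom C a b \<Longrightarrow> g \<in> Hom C b c \<Longrightarrow> h \<in> Hom C c d \<Longrightarrow> (h \<cdot> g) \<cdot> f = h \<cdot> (g \<cdot> f)"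

definition inverse_arrows :: "('o, 'm, 'z) category_data_scheme \<Rightarrow> 'm \<Rightarrow> 'm \<Rightarrow> bool" where
  "inverse_arrows C f g \<longleftrightarrow>
     f \<in> Arr C \<and> g \<in> Hom C (Cod C f) (Dom C f) \<and>
     g \<cdot>\<^bsub>C\<^esub> f = Ident C (Dom C f) \<and> f \<cdot>\<^bsub>C\<^esub> g = Ident C (Cod C f)"

definition is_iso :: "('o, 'm, 'z) category_data_scheme \<Rightarrow> 'm \<Rightarrow> bool" where
  "is_iso C f \<longleftrightarrow> (\<exists>g. inverse_arrows C f g)"

definition inverse_arrow :: "('o, 'm, 'z) category_data_scheme \<Rightarrow> 'm \<Rightarrow> 'm" where
  "inverse_arrow C f = (THE g. inverse_arrows C f g)"

record ('o1, 'm1, 'o2, 'm2) functor_data =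
  onObj :: "'o1 \<Rightarrow> 'o2"
  onArr :: "'m1 \<Rightarrow> 'm2"

definition comp_functor ::
  "('o2, 'm2, 'o3, 'm3, 'y) functor_data_scheme \<Rightarrow> ('o1, 'm1, 'o2, 'm2, 'z) functor_data_scheme
     \<Rightarrow> ('o1, 'm1, 'o3, 'm3) functor_data"  (infixr "\<circ>\<^sub>F" 75) where
  "G \<circ>\<^sub>F F = \<lparr>onObj = \<lambda>a. onObj G (onObj F a), onArr = \<lambda>f. onArr G (onArr F f)\<rparr>"

definition id_functor :: "('o, 'm, 'o, 'm) functor_data" where
  "id_functor = \<lparr>onObj = \<lambda>a. a, onArr = \<lambda>f. f\<rparr>"

locale functor_between = A: category A + B: category B
  for A :: "('o1, 'm1, 'x) category_data_scheme"
    and B :: "('o2, 'm2, 'y) category_data_scheme" +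
  fixes F :: "('o1, 'm1, 'o2, 'm2, 'z) functor_data_scheme"
  assumes onObj_in_Obj: "a \<in> Obj A \<Longrightarrow> onObj F a \<in> Obj B"
    and onArr_in_Hom: "f \<in> Hom A a b \<Longrightarrow> onArr F f \<in> Hom B (onObj F a) (onObj F b)"
    and onArr_Ident: "a \<in> Obj A \<Longrightarrow> onArr F (Ident A a) = Ident B (onObj F a)"
    and onArr_Comp: "f \<in> Hom A a b \<Longrightarrow> g \<in> Hom A b c \<Longrightarrow>
      onArr F (g \<cdot>\<^bsub>A\<^esub> f) = onArr F g \<cdot>\<^bsub>B\<^esub> onArr F f"

locale natural_transformation = F: functor_between A B F + G: functor_between A B G
  for A :: "('o1, 'm1, 'x) category_data_scheme"
    and B :: "('o2, 'm2, 'y) category_data_scheme"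
    and F :: "('o1, 'm1, 'o2, 'm2, 'z) functor_data_scheme"
    and G :: "('o1, 'm1, 'o2, 'm2, 'w) functor_data_scheme" +
  fixes \<tau> :: "'o1 \<Rightarrow> 'm2"
  assumes component_in_Hom: "a \<in> Obj A \<Longrightarrow> \<tau> a \<in> Hom B (onObj F a) (onObj G a)"
    and naturality: "f \<in> Hom A a b \<Longrightarrow> \<tau> b \<cdot>\<^bsub>B\<^esub> onArr F f = onArr G f \<cdot>\<^bsub>B\<^esub> \<tau> a"

locale natural_isomorphism = natural_transformation +
  assumes component_iso: "a \<in> Obj A \<Longrightarrow> is_iso B (\<tau> a)"

definition naturally_isomorphic ::
  "('o1, 'm1, 'x) category_data_scheme \<Rightarrow> ('o2, 'm2, 'y) category_data_scheme
     \<Rightarrow> ('o1, 'm1, 'o2, 'm2, 'z) functor_data_scheme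
     \<Rightarrow> ('o1, 'm1, 'o2, 'm2, 'w) functor_data_scheme \<Rightarrow> bool" where
  "naturally_isomorphic A B F G \<longleftrightarrow> (\<exists>\<tau>. natural_isomorphism A B F G \<tau>)"

locale adjunction =
  F: functor_between C D F + U: functor_between D C U +
  unit: natural_transformation C C id_functor "U \<circ>\<^sub>F F" \<eta> +
  counit: natural_transformation D D "F \<circ>\<^sub>F U" id_functor \<epsilon>
  for C :: "('o1, 'm1, 'x) category_data_scheme"
    and D :: "('o2, 'm2, 'y) category_data_scheme"
    and F :: "('o1, 'm1, 'o2, 'm2, 'z) functor_data_scheme"
    and U :: "('o2, 'm2, 'o1, 'm1, 'w) functor_data_scheme"
    and \<eta> :: "'o1 \<Rightarrow> 'm1"
    and \<epsilon> :: "'o2 \<Rightarrow> 'm2" +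
  assumes triangle_left:
      "X \<in> Obj C \<Longrightarrow> \<epsilon> (onObj F X) \<cdot>\<^bsub>D\<^esub> onArr F (\<eta> X) = Ident D (onObj F X)"
    and triangle_right:
      "Y \<in> Obj D \<Longrightarrow> onArr U (\<epsilon> Y) \<cdot>\<^bsub>C\<^esub> \<eta> (onObj U Y) = Ident C (onObj U Y)"


section \<open>Symmetric monoidal categories\<close>

text \<open>
  Orientations: \<open>Assoc X Y Z : (X \<otimes> Y) \<otimes> Z \<rightarrow> X \<otimes> (Y \<otimes> Z)\<close>,
  \<open>LUnit X : I \<otimes> X \<rightarrow> X\<close>, \<open>RUnit X : X \<otimes> I \<rightarrow> X\<close>, \<open>Braid X Y : X \<otimes> Y \<rightarrow> Y \<otimes> X\<close>.
\<close>

record ('o, 'm) monoidal_data = "('o, 'm) category_data" +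
  TensorObj :: "'o \<Rightarrow> 'o \<Rightarrow> 'o"  (infixr "\<otimes>\<index>" 72)
  TensorArr :: "'m \<Rightarrow> 'm \<Rightarrow> 'm"  (infixr "\<boxtimes>\<index>" 72)
  UnitObj :: 'o
  Assoc :: "'o \<Rightarrow> 'o \<Rightarrow> 'o \<Rightarrow> 'm"
  LUnit :: "'o \<Rightarrow> 'm"
  RUnit :: "'o \<Rightarrow> 'm"

record ('o, 'm) symmetric_monoidal_data = "('o, 'm) monoidal_data" +
  Braid :: "'o \<Rightarrow> 'o \<Rightarrow> 'm"

locale monoidal_category = category C
  for C :: "('o, 'm, 'z) monoidal_data_scheme" (structure) +
  assumes UnitObj_in_Obj: "UnitObj C \<in> Obj C"
    and TensorObj_in_Obj: "X \<in> Obj C \<Longrightarrow> Y \<in> Obj C \<Longrightarrow> X \<otimes> Y \<in> Obj C"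
    and TensorArr_in_Hom:
      "f \<in> Hom C X X' \<Longrightarrow> g \<in> Hom C Y Y' \<Longrightarrow> f \<boxtimes> g \<in> Hom C (X \<otimes> Y) (X' \<otimes> Y')"
    and TensorArr_Ident:
      "X \<in> Obj C \<Longrightarrow> Y \<in> Obj C \<Longrightarrow> Ident C X \<boxtimes> Ident C Y = Ident C (X \<otimes> Y)"
    and TensorArr_Comp:
      "f \<in> Hom C X X' \<Longrightarrow> f' \<in> Hom C X' X'' \<Longrightarrow> g \<in> Hom C Y Y' \<Longrightarrow> g' \<in> Hom C Y' Y'' \<Longrightarrow>
       (f' \<cdot> f) \<boxtimes> (g' \<cdot> g) = (f' \<boxtimes> g') \<cdot> (f \<boxtimes> g)"
    and Assoc_in_Hom:
      "X \<in> Obj C \<Longrightarrow> Y \<in> Obj C \<Longrightarrow> Z \<in> Obj C \<Longrightarrow>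
       Assoc C X Y Z \<in> Hom C ((X \<otimes> Y) \<otimes> Z) (X \<otimes> (Y \<otimes> Z))"
    and Assoc_iso:
      "X \<in> Obj C \<Longrightarrow> Y \<in> Obj C \<Longrightarrow> Z \<in> Obj C \<Longrightarrow> is_iso C (Assoc C X Y Z)"
    and Assoc_natural:
      "f \<in> Hom C X X' \<Longrightarrow> g \<in> Hom C Y Y' \<Longrightarrow> h \<in> Hom C Z Z' \<Longrightarrow>
       Assoc C X' Y' Z' \<cdot> ((f \<boxtimes> g) \<boxtimes> h) = (f \<boxtimes> (g \<boxtimes> h)) \<cdot> Assoc C X Y Z"
    and LUnit_in_Hom: "X \<in> Obj C \<Longrightarrow> LUnit C X \<in> Hom C (UnitObj C \<otimes> X) X"
    and LUnit_iso: "X \<in> Obj C \<Longrightarrow> is_iso C (LUnit C X)"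
    and LUnit_natural:
      "f \<in> Hom C X Y \<Longrightarrow> LUnit C Y \<cdot> (Ident C (UnitObj C) \<boxtimes> f) = f \<cdot> LUnit C X"
    and RUnit_in_Hom: "X \<in> Obj C \<Longrightarrow> RUnit C X \<in> Hom C (X \<otimes> UnitObj C) X"
    and RUnit_iso: "X \<in> Obj C \<Longrightarrow> is_iso C (RUnit C X)"
    and RUnit_natural:
      "f \<in> Hom C X Y \<Longrightarrow> RUnit C Y \<cdot> (f \<boxtimes> Ident C (UnitObj C)) = f \<cdot> RUnit C X"
    and triangle:
      "X \<in> Obj C \<Longrightarrow> Y \<in> Obj C \<Longrightarrow>
       (Ident C X \<boxtimes> LUnit C Y) \<cdot> Assoc C X (UnitObj C) Y = RUnit C X \<boxtimes> Ident C Y"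
    and pentagon:
      "W \<in> Obj C \<Longrightarrow> X \<in> Obj C \<Longrightarrow> Y \<in> Obj C \<Longrightarrow> Z \<in> Obj C \<Longrightarrow>
       (Ident C W \<boxtimes> Assoc C X Y Z) \<cdot> Assoc C W (X \<otimes> Y) Z \<cdot> (Assoc C W X Y \<boxtimes> Ident C Z)
         = Assoc C W X (Y \<otimes> Z) \<cdot> Assoc C (W \<otimes> X) Y Z"

text \<open>Since the braiding is symmetric, one hexagon implies the other.\<close>

locale symmetric_monoidal_category = monoidal_category C
  for C :: "('o, 'm, 'z) symmetric_monoidal_data_scheme" (structure) +
  assumes Braid_in_Hom: "X \<in> Obj C \<Longrightarrow> Y \<in> Obj C \<Longrightarrow> Braid C X Y \<in> Hom C (X \<otimes> Y) (Y \<otimes> X)"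
    and Braid_natural:
      "f \<in> Hom C X X' \<Longrightarrow> g \<in> Hom C Y Y' \<Longrightarrow>
       Braid C X' Y' \<cdot> (f \<boxtimes> g) = (g \<boxtimes> f) \<cdot> Braid C X Y"
    and Braid_symmetric:
      "X \<in> Obj C \<Longrightarrow> Y \<in> Obj C \<Longrightarrow> Braid C Y X \<cdot> Braid C X Y = Ident C (X \<otimes> Y)"
    and hexagon:
      "X \<in> Obj C \<Longrightarrow> Y \<in> Obj C \<Longrightarrow> Z \<in> Obj C \<Longrightarrow>
       Assoc C Y Z X \<cdot> Braid C X (Y \<otimes> Z) \<cdot> Assoc C X Y Z
         = (Ident C Y \<boxtimes> Braid C X Z) \<cdot> Assoc C Y X Z \<cdot> (Braid C X Y \<boxtimes> Ident C Z)"


section \<open>Strong monoidal adjunctions\<close>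

text \<open>
  Structure maps: \<open>MuF X Y : F X \<otimes> F Y \<rightarrow> F (X \<otimes> Y)\<close> and \<open>UnitF : I \<rightarrow> F I\<close>.
\<close>

record ('o1, 'm1, 'o2, 'm2) monoidal_functor_data = "('o1, 'm1, 'o2, 'm2) functor_data" +
  MuF :: "'o1 \<Rightarrow> 'o1 \<Rightarrow> 'm2"
  UnitF :: 'm2

locale strong_symmetric_monoidal_functor =
  C: symmetric_monoidal_category C + D: symmetric_monoidal_category D + functor_between C D F
  for C :: "('o1, 'm1, 'x) symmetric_monoidal_data_scheme"
    and D :: "('o2, 'm2, 'y) symmetric_monoidal_data_scheme"
    and F :: "('o1, 'm1, 'o2, 'm2, 'z) monoidal_functor_data_scheme" +
  assumes MuF_in_Hom:
      "X \<in> Obj C \<Longrightarrow> Y \<in> Obj C \<Longrightarrow>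
       MuF F X Y \<in> Hom D (onObj F X \<otimes>\<^bsub>D\<^esub> onObj F Y) (onObj F (X \<otimes>\<^bsub>C\<^esub> Y))"
    and MuF_iso: "X \<in> Obj C \<Longrightarrow> Y \<in> Obj C \<Longrightarrow> is_iso D (MuF F X Y)"
    and MuF_natural:
      "f \<in> Hom C X X' \<Longrightarrow> g \<in> Hom C Y Y' \<Longrightarrow>
       MuF F X' Y' \<cdot>\<^bsub>D\<^esub> (onArr F f \<boxtimes>\<^bsub>D\<^esub> onArr F g) = onArr F (f \<boxtimes>\<^bsub>C\<^esub> g) \<cdot>\<^bsub>D\<^esub> MuF F X Y"
    and UnitF_in_Hom: "UnitF F \<in> Hom D (UnitObj D) (onObj F (UnitObj C))"
    and UnitF_iso: "is_iso D (UnitF F)"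
    and MuF_assoc:
      "X \<in> Obj C \<Longrightarrow> Y \<in> Obj C \<Longrightarrow> Z \<in> Obj C \<Longrightarrow>
       onArr F (Assoc C X Y Z) \<cdot>\<^bsub>D\<^esub> MuF F (X \<otimes>\<^bsub>C\<^esub> Y) Z \<cdot>\<^bsub>D\<^esub> (MuF F X Y \<boxtimes>\<^bsub>D\<^esub> Ident D (onObj F Z))
         = MuF F X (Y \<otimes>\<^bsub>C\<^esub> Z) \<cdot>\<^bsub>D\<^esub> (Ident D (onObj F X) \<boxtimes>\<^bsub>D\<^esub> MuF F Y Z)
             \<cdot>\<^bsub>D\<^esub> Assoc D (onObj F X) (onObj F Y) (onObj F Z)"
    and MuF_LUnit:
      "X \<in> Obj C \<Longrightarrow>
       onArr F (LUnit C X) \<cdot>\<^bsub>D\<^esub> MuF F (UnitObj C) X \<cdot>\<^bsub>D\<^esub> (UnitF F \<boxtimes>\<^bsub>D\<^esub> Ident D (onObj F X))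
         = LUnit D (onObj F X)"
    and MuF_RUnit:
      "X \<in> Obj C \<Longrightarrow>
       onArr F (RUnit C X) \<cdot>\<^bsub>D\<^esub> MuF F X (UnitObj C) \<cdot>\<^bsub>D\<^esub> (Ident D (onObj F X) \<boxtimes>\<^bsub>D\<^esub> UnitF F)
         = RUnit D (onObj F X)"
    and MuF_Braid:
      "X \<in> Obj C \<Longrightarrow> Y \<in> Obj C \<Longrightarrow>
       onArr F (Braid C X Y) \<cdot>\<^bsub>D\<^esub> MuF F X Y = MuF F Y X \<cdot>\<^bsub>D\<^esub> Braid D (onObj F X) (onObj F Y)"

text \<open>No monoidal structure on the right adjoint is assumed: it is the one induced by the adjunction.\<close>

locale strong_monoidal_adjunction =
  strong_symmetric_monoidal_functor C D F + adjunction C D F U \<eta> \<epsilon>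
  for C :: "('o1, 'm1, 'x) symmetric_monoidal_data_scheme"
    and D :: "('o2, 'm2, 'y) symmetric_monoidal_data_scheme"
    and F :: "('o1, 'm1, 'o2, 'm2, 'z) monoidal_functor_data_scheme"
    and U :: "('o2, 'm2, 'o1, 'm1, 'w) functor_data_scheme"
    and \<eta> :: "'o1 \<Rightarrow> 'm1"
    and \<epsilon> :: "'o2 \<Rightarrow> 'm2"

text \<open>
  The lax structure map of \<open>U\<close>, the mate of the inverse of \<open>MuF\<close>:
  \<open>U X \<otimes> U Y \<rightarrow> U F (U X \<otimes> U Y) \<rightarrow> U (F U X \<otimes> F U Y) \<rightarrow> U (X \<otimes> Y)\<close>.
  (The lax unit map of \<open>U\<close> does not enter the definition of the induced functor on modules.)
\<close>

definition laxU ::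
  "('o1, 'm1, 'x) symmetric_monoidal_data_scheme \<Rightarrow> ('o2, 'm2, 'y) symmetric_monoidal_data_scheme
     \<Rightarrow> ('o1, 'm1, 'o2, 'm2, 'z) monoidal_functor_data_scheme
     \<Rightarrow> ('o2, 'm2, 'o1, 'm1, 'w) functor_data_scheme
     \<Rightarrow> ('o1 \<Rightarrow> 'm1) \<Rightarrow> ('o2 \<Rightarrow> 'm2) \<Rightarrow> 'o2 \<Rightarrow> 'o2 \<Rightarrow> 'm1" where
  "laxU C D F U \<eta> \<epsilon> X Y =
     onArr U (\<epsilon> X \<boxtimes>\<^bsub>D\<^esub> \<epsilon> Y)
     \<cdot>\<^bsub>C\<^esub> onArr U (inverse_arrow D (MuF F (onObj U X) (onObj U Y)))
     \<cdot>\<^bsub>C\<^esub> \<eta> (onObj U X \<otimes>\<^bsub>C\<^esub> onObj U Y)"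


section \<open>Monoids and modules\<close>

record ('o, 'm) monoid_data =
  MonObj :: 'o
  Mult :: 'm
  MonUnit :: 'm

locale monoid_object = monoidal_category C
  for C :: "('o, 'm, 'z) monoidal_data_scheme" (structure) +
  fixes S :: "('o, 'm) monoid_data"
  assumes MonObj_in_Obj: "MonObj S \<in> Obj C"
    and Mult_in_Hom: "Mult S \<in> Hom C (MonObj S \<otimes> MonObj S) (MonObj S)"
    and MonUnit_in_Hom: "MonUnit S \<in> Hom C (UnitObj C) (MonObj S)"
    and Mult_assoc:
      "Mult S \<cdot> (Mult S \<boxtimes> Ident C (MonObj S))
         = Mult S \<cdot> (Ident C (MonObj S) \<boxtimes> Mult S) \<cdot> Assoc C (MonObj S) (MonObj S) (MonObj S)"
    and Mult_left_unit:
      "Mult S \<cdot> (MonUnit S \<boxtimes> Ident C (MonObj S)) = LUnit C (MonObj S)"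
    and Mult_right_unit:
      "Mult S \<cdot> (Ident C (MonObj S) \<boxtimes> MonUnit S) = RUnit C (MonObj S)"

locale monoid_map = S: monoid_object C S + R: monoid_object C R
  for C :: "('o, 'm, 'z) monoidal_data_scheme" (structure)
    and S :: "('o, 'm) monoid_data"
    and R :: "('o, 'm) monoid_data" +
  fixes \<theta> :: 'm
  assumes map_in_Hom: "\<theta> \<in> Hom C (MonObj S) (MonObj R)"
    and map_Mult: "\<theta> \<cdot> Mult S = Mult R \<cdot> (\<theta> \<boxtimes> \<theta>)"
    and map_MonUnit: "\<theta> \<cdot> MonUnit S = MonUnit R"

record ('o, 'm) module_data =
  ModObj :: 'o
  Act :: 'm

definition is_module ::
  "('o, 'm, 'z) monoidal_data_scheme \<Rightarrow> ('o, 'm) monoid_data \<Rightarrow> ('o, 'm) module_data \<Rightarrow> bool" where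
  "is_module C S M \<longleftrightarrow>
     ModObj M \<in> Obj C \<and>
     Act M \<in> Hom C (MonObj S \<otimes>\<^bsub>C\<^esub> ModObj M) (ModObj M) \<and>
     Act M \<cdot>\<^bsub>C\<^esub> (Mult S \<boxtimes>\<^bsub>C\<^esub> Ident C (ModObj M))
       = Act M \<cdot>\<^bsub>C\<^esub> (Ident C (MonObj S) \<boxtimes>\<^bsub>C\<^esub> Act M) \<cdot>\<^bsub>C\<^esub> Assoc C (MonObj S) (MonObj S) (ModObj M) \<and>
     Act M \<cdot>\<^bsub>C\<^esub> (MonUnit S \<boxtimes>\<^bsub>C\<^esub> Ident C (ModObj M)) = LUnit C (ModObj M)"

definition is_module_map ::
  "('o, 'm, 'z) monoidal_data_scheme \<Rightarrow> ('o, 'm) monoid_data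
     \<Rightarrow> ('o, 'm) module_data \<Rightarrow> ('o, 'm) module_data \<Rightarrow> 'm \<Rightarrow> bool" where
  "is_module_map C S M N f \<longleftrightarrow>
     f \<in> Hom C (ModObj M) (ModObj N) \<and>
     f \<cdot>\<^bsub>C\<^esub> Act M = Act N \<cdot>\<^bsub>C\<^esub> (Ident C (MonObj S) \<boxtimes>\<^bsub>C\<^esub> f)"

text \<open>
  An arrow of the module category carries its source and target modules, because the underlying
  arrow of \<open>C\<close> does not determine the actions.
\<close>

record ('o, 'm) module_arrow =
  Src :: "('o, 'm) module_data"
  Trg :: "('o, 'm) module_data"
  Und :: 'm

definition Mod ::
  "('o, 'm, 'z) monoidal_data_scheme \<Rightarrow> ('o, 'm) monoid_data
     \<Rightarrow> (('o, 'm) module_data, ('o, 'm) module_arrow) category_data" where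
  "Mod C S =
     \<lparr>Obj = {M. is_module C S M},
      Arr = {f. is_module C S (Src f) \<and> is_module C S (Trg f)
                \<and> is_module_map C S (Src f) (Trg f) (Und f)},
      Dom = Src,
      Cod = Trg,
      Ident = \<lambda>M. \<lparr>Src = M, Trg = M, Und = Ident C (ModObj M)\<rparr>,
      Comp = \<lambda>g f. \<lparr>Src = Src f, Trg = Trg g, Und = Und g \<cdot>\<^bsub>C\<^esub> Und f\<rparr>\<rparr>"

definition functor_on_modules ::
  "(('o1, 'm1) module_data \<Rightarrow> ('o2, 'm2) module_data) \<Rightarrow> ('m1 \<Rightarrow> 'm2)
     \<Rightarrow> (('o1, 'm1) module_data, ('o1, 'm1) module_arrow,
         ('o2, 'm2) module_data, ('o2, 'm2) module_arrow) functor_data" where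
  "functor_on_modules T t =
     \<lparr>onObj = T, onArr = \<lambda>f. \<lparr>Src = T (Src f), Trg = T (Trg f), Und = t (Und f)\<rparr>\<rparr>"

definition restriction ::
  "('o, 'm, 'z) monoidal_data_scheme \<Rightarrow> 'm
     \<Rightarrow> (('o, 'm) module_data, ('o, 'm) module_arrow,
         ('o, 'm) module_data, ('o, 'm) module_arrow) functor_data" where
  "restriction C \<theta> =
     functor_on_modules
       (\<lambda>M. \<lparr>ModObj = ModObj M, Act = Act M \<cdot>\<^bsub>C\<^esub> (\<theta> \<boxtimes>\<^bsub>C\<^esub> Ident C (ModObj M))\<rparr>)
       (\<lambda>f. f)"


section \<open>The functors induced by a strong monoidal adjunction\<close>

definition image_monoid ::
  "('o2, 'm2, 'y) symmetric_monoidal_data_scheme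
     \<Rightarrow> ('o1, 'm1, 'o2, 'm2, 'z) monoidal_functor_data_scheme
     \<Rightarrow> ('o1, 'm1) monoid_data \<Rightarrow> ('o2, 'm2) monoid_data" where
  "image_monoid D F S =
     \<lparr>MonObj = onObj F (MonObj S),
      Mult = onArr F (Mult S) \<cdot>\<^bsub>D\<^esub> MuF F (MonObj S) (MonObj S),
      MonUnit = onArr F (MonUnit S) \<cdot>\<^bsub>D\<^esub> UnitF F\<rparr>"

text \<open>\<open>F\<close> from \<open>S\<close>-modules to \<open>F S\<close>-modules: the action is \<open>F S \<otimes> F M \<rightarrow> F (S \<otimes> M) \<rightarrow> F M\<close>.\<close>

definition left_on_modules ::
  "('o2, 'm2, 'y) symmetric_monoidal_data_scheme
     \<Rightarrow> ('o1, 'm1, 'o2, 'm2, 'z) monoidal_functor_data_scheme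
     \<Rightarrow> ('o1, 'm1) monoid_data
     \<Rightarrow> (('o1, 'm1) module_data, ('o1, 'm1) module_arrow,
         ('o2, 'm2) module_data, ('o2, 'm2) module_arrow) functor_data" where
  "left_on_modules D F S =
     functor_on_modules
       (\<lambda>M. \<lparr>ModObj = onObj F (ModObj M),
             Act = onArr F (Act M) \<cdot>\<^bsub>D\<^esub> MuF F (MonObj S) (ModObj M)\<rparr>)
       (onArr F)"

text \<open>
  \<open>U\<close> from \<open>F S\<close>-modules to \<open>S\<close>-modules: the action is
  \<open>S \<otimes> U N \<rightarrow> U F S \<otimes> U N \<rightarrow> U (F S \<otimes> N) \<rightarrow> U N\<close>.
\<close>

definition right_on_modules ::
  "('o1, 'm1, 'x) symmetric_monoidal_data_scheme \<Rightarrow> ('o2, 'm2, 'y) symmetric_monoidal_data_scheme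
     \<Rightarrow> ('o1, 'm1, 'o2, 'm2, 'z) monoidal_functor_data_scheme
     \<Rightarrow> ('o2, 'm2, 'o1, 'm1, 'w) functor_data_scheme
     \<Rightarrow> ('o1 \<Rightarrow> 'm1) \<Rightarrow> ('o2 \<Rightarrow> 'm2) \<Rightarrow> ('o1, 'm1) monoid_data
     \<Rightarrow> (('o2, 'm2) module_data, ('o2, 'm2) module_arrow,
         ('o1, 'm1) module_data, ('o1, 'm1) module_arrow) functor_data" where
  "right_on_modules C D F U \<eta> \<epsilon> S =
     functor_on_modules
       (\<lambda>N. \<lparr>ModObj = onObj U (ModObj N),
             Act = onArr U (Act N)
                   \<cdot>\<^bsub>C\<^esub> laxU C D F U \<eta> \<epsilon> (onObj F (MonObj S)) (ModObj N)
                   \<cdot>\<^bsub>C\<^esub> (\<eta> (MonObj S) \<boxtimes>\<^bsub>C\<^esub> Ident C (onObj U (ModObj N)))\<rparr>)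
       (onArr U)"

end

theory Submission
  imports Defs
begin

text \<open>
  Both isomorphisms are identities: the two composites agree on objects and arrows, so it suffices
  that one composite of each pair is a functor. For a map \<open>h : F X \<otimes> N \<rightarrow> N'\<close> in \<open>D\<close>, the induced
  map \<open>a : X \<otimes> U N \<rightarrow> U N'\<close> is determined by \<open>\<epsilon> \<cdot> F a \<cdot> MuF = h \<cdot> (1 \<otimes> \<epsilon>)\<close>, because transposition
  along the adjunction is injective and \<open>MuF\<close> is invertible. The module axioms for \<open>U N\<close>, and
  the equation between the two restricted actions, thereby become identities in \<open>D\<close>.
\<close>

section \<open>Composition of arrows\<close>

context category
begin

text \<open>The axioms give endpoints through \<open>Hom\<close>, so some of them would have to be
  guessed when rewriting. They are restated through \<open>Arr\<close>, \<open>Dom\<close> and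
  \<open>Cod\<close>, which makes every side condition computable.\<close>

lemma Ident_Arr [simp]:
  assumes "a \<in> Obj C"
  shows "Ident C a \<in> Arr C" "Dom C (Ident C a) = a" "Cod C (Ident C a) = a"
  using Ident_in_Hom[OF assms] by (auto simp: Hom_def)

lemma Comp_Arr [simp]:
  assumes "f \<in> Arr C" "g \<in> Arr C" "Dom C g = Cod C f"
  shows "g \<cdot> f \<in> Arr C" "Dom C (g \<cdot> f) = Dom C f" "Cod C (g \<cdot> f) = Cod C g"
  using Comp_in_Hom[of f "Dom C f" "Cod C f" g "Cod C g"] assms by (auto simp: Hom_def)

lemma Comp_Ident_Dom [simp]: "f \<in> Arr C \<Longrightarrow> Dom C f = a \<Longrightarrow> f \<cdot> Ident C a = f"
  by (rule Comp_Ident) (auto simp: Hom_def)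

lemma Ident_Cod_Comp [simp]: "f \<in> Arr C \<Longrightarrow> Cod C f = a \<Longrightarrow> Ident C a \<cdot> f = f"
  by (rule Ident_Comp) (auto simp: Hom_def)

lemma Comp_assoc_Arr [simp]:
  "f \<in> Arr C \<Longrightarrow> g \<in> Arr C \<Longrightarrow> h \<in> Arr C \<Longrightarrow> Dom C g = Cod C f \<Longrightarrow> Dom C h = Cod C g \<Longrightarrow>
   (h \<cdot> g) \<cdot> f = h \<cdot> (g \<cdot> f)"
  by (rule Comp_assoc) (auto simp: Hom_def)

declare Dom_in_Obj [simp] Cod_in_Obj [simp]

text \<open>In right-nested composites \<open>p \<cdot> q\<close> is hidden inside
  \<open>p \<cdot> (q \<cdot> k)\<close>. This makes an equation for \<open>p \<cdot> q\<close>
  usable in front of any \<open>k\<close>; \<open>interchange_Comp\<close> and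
  \<open>MuF_natural_Comp\<close> arise this way.\<close>

lemma Comp_reassoc:
  assumes "p \<cdot> q = r" "p \<in> Arr C" "q \<in> Arr C" "Dom C p = Cod C q" "k \<in> Arr C" "Cod C k = Dom C q"
  shows "p \<cdot> (q \<cdot> k) = r \<cdot> k"
  using assms Comp_assoc_Arr[of k q p] by simp

text \<open>Bracketing \<open>h \<cdot> f \<cdot> g\<close> both ways gives \<open>g\<close> and
  \<open>h\<close>. This makes the definite description in \<open>inverse_arrow\<close>
  meaningful.\<close>

lemma inverse_arrows_unique:
  assumes "inverse_arrows C f g" "inverse_arrows C f h"
  shows "g = h"
proof -
  have "(h \<cdot> f) \<cdot> g = h \<cdot> (f \<cdot> g)"
    using assms by (intro Comp_assoc_Arr) (auto simp: inverse_arrows_def Hom_def)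
  then show ?thesis
    using assms by (auto simp: inverse_arrows_def Hom_def)
qed

lemma inverse_arrows_inverse_arrow:
  assumes "is_iso C f"
  shows "inverse_arrows C f (inverse_arrow C f)"
proof -
  obtain g where g: "inverse_arrows C f g"
    using assms by (auto simp: is_iso_def)
  show ?thesis
    unfolding inverse_arrow_def
    by (rule theI[of _ g]) (use g inverse_arrows_unique in blast)+
qed

text \<open>Composing with an inverse of \<open>m\<close> recovers \<open>f\<close> and
  \<open>g\<close>. Equations in \<open>D\<close> are proved after precomposition with structure
  maps of \<open>F\<close>, which are then cancelled.\<close>

lemma iso_cancel_right:
  assumes "is_iso C m" "f \<in> Arr C" "g \<in> Arr C" "Dom C f = Cod C m" "Dom C g = Cod C m"
    and "f \<cdot> m = g \<cdot> m"
  shows "f = g"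
proof -
  obtain n where "inverse_arrows C m n"
    using assms(1) by (auto simp: is_iso_def)
  then have n: "m \<in> Arr C" "n \<in> Arr C" "Dom C n = Cod C m" "Cod C n = Dom C m"
    "m \<cdot> n = Ident C (Cod C m)"
    by (auto simp: inverse_arrows_def Hom_def)
  have "f = (f \<cdot> m) \<cdot> n" "(g \<cdot> m) \<cdot> n = g"
    using assms(2-5) n by simp_all
  with assms(6) show ?thesis by simp
qed

lemma is_iso_Ident: "a \<in> Obj C \<Longrightarrow> is_iso C (Ident C a)"
  unfolding is_iso_def inverse_arrows_def by (rule exI[of _ "Ident C a"]) (simp add: Hom_def)

end

section \<open>Functors and natural isomorphisms\<close>

context functor_between
begin

lemma onArr_Arr [simp]:
  assumes "f \<in> Arr A"
  shows "onArr F f \<in> Arr B" "Dom B (onArr F f) = onObj F (Dom A f)"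
    "Cod B (onArr F f) = onObj F (Cod A f)"
  using onArr_in_Hom[of f "Dom A f" "Cod A f"] assms by (auto simp: Hom_def)

declare onObj_in_Obj [simp] onArr_Ident [simp]

lemma onArr_Comp_Arr [simp]:
  "f \<in> Arr A \<Longrightarrow> g \<in> Arr A \<Longrightarrow> Dom A g = Cod A f \<Longrightarrow>
   onArr F (g \<cdot>\<^bsub>A\<^esub> f) = onArr F g \<cdot>\<^bsub>B\<^esub> onArr F f"
  by (rule onArr_Comp) (auto simp: Hom_def)

text \<open>The functor laws evaluate \<open>G\<close> only on \<open>Obj A\<close> and
  \<open>Arr A\<close>, so agreement on these carriers transfers them; values elsewhere are
  arbitrary.\<close>

lemma functor_between_cong:
  assumes "\<And>a. a \<in> Obj A \<Longrightarrow> onObj G a = onObj F a"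
    and "\<And>f. f \<in> Arr A \<Longrightarrow> onArr G f = onArr F f"
  shows "functor_between A B G"
  by unfold_locales (auto simp: assms Hom_def)

text \<open>Identity arrows serve as components: naturality reduces to the unit laws, and identities
  are invertible.\<close>

lemma naturally_isomorphic_if_equal:
  assumes "\<And>a. a \<in> Obj A \<Longrightarrow> onObj G a = onObj F a"
    and "\<And>f. f \<in> Arr A \<Longrightarrow> onArr G f = onArr F f"
  shows "naturally_isomorphic A B F G"
proof -
  interpret G: functor_between A B G
    using assms by (rule functor_between_cong)
  have "natural_isomorphism A B F G (\<lambda>a. Ident B (onObj F a))"
    by unfold_locales (auto simp: assms Hom_def intro: B.is_iso_Ident)
  then show ?thesis
    by (auto simp: naturally_isomorphic_def)
qed

end

lemma functor_between_comp:
  assumes "functor_between A B F" "functor_between B E G"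
  shows "functor_between A E (G \<circ>\<^sub>F F)"
proof -
  interpret F: functor_between A B F by fact
  interpret G: functor_between B E G by fact
  show ?thesis
    by unfold_locales (auto simp: comp_functor_def Hom_def)
qed

lemma (in category) functor_between_id: "functor_between C C id_functor"
  by unfold_locales (auto simp: id_functor_def)

lemma (in natural_transformation) component_Arr:
  assumes "a \<in> Obj A"
  shows "\<tau> a \<in> Arr B" "Dom B (\<tau> a) = onObj F a" "Cod B (\<tau> a) = onObj G a"
  using component_in_Hom[OF assms] by (auto simp: Hom_def)


section \<open>Tensor products of arrows\<close>

context monoidal_category
begin

declare UnitObj_in_Obj [simp] TensorObj_in_Obj [simp] TensorArr_Ident [simp]

lemma TensorArr_Arr [simp]:
  assumes "f \<in> Arr C" "g \<in> Arr C"
  shows "f \<boxtimes> g \<in> Arr C" "Dom C (f \<boxtimes> g) = Dom C f \<otimes> Dom C g" "Cod C (f \<boxtimes> g) = Cod C f \<otimes> Cod C g"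
  using TensorArr_in_Hom[of f "Dom C f" "Cod C f" g "Dom C g" "Cod C g"] assms
  by (auto simp: Hom_def)

lemma interchange [simp]:
  assumes "f \<in> Arr C" "f' \<in> Arr C" "g \<in> Arr C" "g' \<in> Arr C" "Dom C f' = Cod C f" "Dom C g' = Cod C g"
  shows "(f' \<boxtimes> g') \<cdot> (f \<boxtimes> g) = (f' \<cdot> f) \<boxtimes> (g' \<cdot> g)"
  using TensorArr_Comp[of f "Dom C f" "Cod C f" f' "Cod C f'" g "Dom C g" "Cod C g" g' "Cod C g'"] assms
  by (simp add: Hom_def)

lemma interchange_Comp [simp]:
  assumes "f \<in> Arr C" "f' \<in> Arr C" "g \<in> Arr C" "g' \<in> Arr C" "Dom C f' = Cod C f" "Dom C g' = Cod C g"
    and "k \<in> Arr C" "Cod C k = Dom C f \<otimes> Dom C g"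
  shows "(f' \<boxtimes> g') \<cdot> ((f \<boxtimes> g) \<cdot> k) = ((f' \<cdot> f) \<boxtimes> (g' \<cdot> g)) \<cdot> k"
  by (rule Comp_reassoc) (use assms in simp_all)

lemma Assoc_Arr [simp]:
  assumes "X \<in> Obj C" "Y \<in> Obj C" "Z \<in> Obj C"
  shows "Assoc C X Y Z \<in> Arr C" "Dom C (Assoc C X Y Z) = (X \<otimes> Y) \<otimes> Z"
    "Cod C (Assoc C X Y Z) = X \<otimes> (Y \<otimes> Z)"
  using Assoc_in_Hom[OF assms] by (auto simp: Hom_def)

lemma LUnit_Arr [simp]:
  assumes "X \<in> Obj C"
  shows "LUnit C X \<in> Arr C" "Dom C (LUnit C X) = UnitObj C \<otimes> X" "Cod C (LUnit C X) = X"
  using LUnit_in_Hom[OF assms] by (auto simp: Hom_def)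

lemma Assoc_natural_Arr:
  "f \<in> Arr C \<Longrightarrow> g \<in> Arr C \<Longrightarrow> h \<in> Arr C \<Longrightarrow>
   Assoc C (Cod C f) (Cod C g) (Cod C h) \<cdot> ((f \<boxtimes> g) \<boxtimes> h)
     = (f \<boxtimes> (g \<boxtimes> h)) \<cdot> Assoc C (Dom C f) (Dom C g) (Dom C h)"
  by (rule Assoc_natural) (auto simp: Hom_def)

lemma LUnit_natural_Arr:
  "f \<in> Arr C \<Longrightarrow> LUnit C (Cod C f) \<cdot> (Ident C (UnitObj C) \<boxtimes> f) = f \<cdot> LUnit C (Dom C f)"
  by (rule LUnit_natural) (auto simp: Hom_def)

lemma is_iso_TensorArr:
  assumes "is_iso C f" "is_iso C g"
  shows "is_iso C (f \<boxtimes> g)"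
proof -
  obtain f' g' where "inverse_arrows C f f'" "inverse_arrows C g g'"
    using assms by (auto simp: is_iso_def)
  then have "inverse_arrows C (f \<boxtimes> g) (f' \<boxtimes> g')"
    by (auto simp: inverse_arrows_def Hom_def)
  then show ?thesis
    by (auto simp: is_iso_def)
qed

end


section \<open>Categories of modules\<close>

lemma Hom_Mod:
  "f \<in> Hom (Mod C S) M N \<longleftrightarrow> Src f = M \<and> Trg f = N \<and> is_module C S M \<and> is_module C S N
     \<and> is_module_map C S M N (Und f)"
  by (auto simp: Hom_def Mod_def)

lemma Mod_simps:
  "M \<in> Obj (Mod C S) \<longleftrightarrow> is_module C S M"
  "Ident (Mod C S) M = \<lparr>Src = M, Trg = M, Und = Ident C (ModObj M)\<rparr>"
  "g \<cdot>\<^bsub>Mod C S\<^esub> f = \<lparr>Src = Src f, Trg = Trg g, Und = Und g \<cdot>\<^bsub>C\<^esub> Und f\<rparr>"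
  by (simp_all add: Mod_def)

context monoidal_category
begin

lemma is_module_ObjD: "is_module C S M \<Longrightarrow> ModObj M \<in> Obj C"
  by (simp add: is_module_def)

lemma is_module_Arr:
  assumes "is_module C S M"
  shows "Act M \<in> Arr C" "Dom C (Act M) = MonObj S \<otimes> ModObj M" "Cod C (Act M) = ModObj M"
  using assms by (auto simp: is_module_def Hom_def)

lemma is_module_Act:
  assumes "is_module C S M"
  shows "Act M \<cdot> (Mult S \<boxtimes> Ident C (ModObj M))
       = Act M \<cdot> (Ident C (MonObj S) \<boxtimes> Act M) \<cdot> Assoc C (MonObj S) (MonObj S) (ModObj M)"
    "Act M \<cdot> (MonUnit S \<boxtimes> Ident C (ModObj M)) = LUnit C (ModObj M)"
  using assms by (auto simp: is_module_def)

lemma is_module_map_Arr: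
  assumes "is_module_map C S M N f"
  shows "f \<in> Arr C" "Dom C f = ModObj M" "Cod C f = ModObj N"
  using assms by (auto simp: is_module_map_def Hom_def)

lemma is_module_map_Act:
  "is_module_map C S M N f \<Longrightarrow> f \<cdot> Act M = Act N \<cdot> (Ident C (MonObj S) \<boxtimes> f)"
  by (simp add: is_module_map_def)

text \<open>The square for a composite is pasted from those of its factors, with interchange merging
  the two tensors. The hypothesis concerns only the carrier, so the lemma applies directly to
  \<open>image_monoid D F S\<close>.\<close>

lemma category_Mod:
  assumes S [simp]: "MonObj S \<in> Obj C"
  shows "category (Mod C S)"
proof
  fix M assume "M \<in> Obj (Mod C S)"
  then have M: "is_module C S M" by (simp add: Mod_def)
  note [simp] = is_module_ObjD[OF M] is_module_Arr[OF M]
  show "Ident (Mod C S) M \<in> Hom (Mod C S) M M"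
    unfolding Hom_Mod by (simp add: M is_module_map_def Mod_def Hom_def)
next
  fix f g K M N
  assume f: "f \<in> Hom (Mod C S) K M" and g: "g \<in> Hom (Mod C S) M N"
  then have mods: "is_module C S K" "is_module C S M" "is_module C S N"
    and maps: "is_module_map C S K M (Und f)" "is_module_map C S M N (Und g)"
    by (auto simp: Hom_Mod)
  note [simp] = mods[THEN is_module_ObjD] mods[THEN is_module_Arr(1)] mods[THEN is_module_Arr(2)]
    mods[THEN is_module_Arr(3)] maps[THEN is_module_map_Arr(1)] maps[THEN is_module_map_Arr(2)]
    maps[THEN is_module_map_Arr(3)]
  have "(Und g \<cdot> Und f) \<cdot> Act K = Und g \<cdot> (Act M \<cdot> (Ident C (MonObj S) \<boxtimes> Und f))"
    by (simp add: is_module_map_Act[OF maps(1)])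
  also have "\<dots> = (Und g \<cdot> Act M) \<cdot> (Ident C (MonObj S) \<boxtimes> Und f)"
    by simp
  also have "\<dots> = Act N \<cdot> (Ident C (MonObj S) \<boxtimes> (Und g \<cdot> Und f))"
    unfolding is_module_map_Act[OF maps(2)] by simp
  finally have "is_module_map C S K N (Und g \<cdot> Und f)"
    by (simp add: is_module_map_def Hom_def)
  with f g show "g \<cdot>\<^bsub>Mod C S\<^esub> f \<in> Hom (Mod C S) K N"
    unfolding Hom_Mod by (auto simp: Mod_def)
qed (auto simp: Hom_Mod is_module_map_def Hom_def Mod_def)

end

text \<open>Identities and composites of module arrows are formed on underlying arrows, so the
  functor laws come from \<open>G\<close>; what remains is preservation of modules and of module
  maps. Restriction, \<open>F\<close> and \<open>U\<close> are all instances.\<close>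

lemma functor_between_functor_on_modules:
  assumes "functor_between C D G"
    and "category (Mod C S)" "category (Mod D S')"
    and obj: "\<And>M. ModObj (T M) = onObj G (ModObj M)"
    and T: "\<And>M. is_module C S M \<Longrightarrow> is_module D S' (T M)"
    and map: "\<And>M N f. is_module C S M \<Longrightarrow> is_module C S N \<Longrightarrow> is_module_map C S M N f
      \<Longrightarrow> is_module_map D S' (T M) (T N) (onArr G f)"
  shows "functor_between (Mod C S) (Mod D S') (functor_on_modules T (onArr G))"
proof -
  interpret G: functor_between C D G by fact
  interpret MC: category "Mod C S" by fact
  interpret MD: category "Mod D S'" by fact
  show ?thesis
  proof
    fix f g K M N assume "f \<in> Hom (Mod C S) K M" "g \<in> Hom (Mod C S) M N"
    then show "onArr (functor_on_modules T (onArr G)) (g \<cdot>\<^bsub>Mod C S\<^esub> f) =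
      onArr (functor_on_modules T (onArr G)) g \<cdot>\<^bsub>Mod D S'\<^esub> onArr (functor_on_modules T (onArr G)) f"
      unfolding Hom_Mod is_module_map_def by (auto simp: Hom_def functor_on_modules_def Mod_simps)
  qed (use T map in \<open>auto simp: Hom_Mod functor_on_modules_def Mod_simps obj\<close>,
      simp add: is_module_def)
qed


section \<open>Restriction of scalars\<close>

context monoid_map
begin

lemma map_Arr [simp]: "\<theta> \<in> Arr C" "Dom C \<theta> = MonObj S" "Cod C \<theta> = MonObj R"
  using map_in_Hom by (auto simp: Hom_def)

lemma is_module_restriction:
  assumes M: "is_module C R M"
  shows "is_module C S (onObj (restriction C \<theta>) M)"
proof -
  note [simp] = S.MonObj_in_Obj R.MonObj_in_Obj S.is_module_ObjD[OF M] S.is_module_Arr[OF M]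
  have [simp]: "Mult S \<in> Arr C" "Dom C (Mult S) = MonObj S \<otimes> MonObj S" "Cod C (Mult S) = MonObj S"
    "Mult R \<in> Arr C" "Dom C (Mult R) = MonObj R \<otimes> MonObj R" "Cod C (Mult R) = MonObj R"
    "MonUnit S \<in> Arr C" "Dom C (MonUnit S) = UnitObj C" "Cod C (MonUnit S) = MonObj S"
    using S.Mult_in_Hom R.Mult_in_Hom S.MonUnit_in_Hom by (auto simp: Hom_def)
  let ?m = "ModObj M" and ?a = "Act M" and ?s = "MonObj S" and ?r = "MonObj R"
  have assoc: "(?a \<cdot> (\<theta> \<boxtimes> Ident C ?m)) \<cdot> (Mult S \<boxtimes> Ident C ?m)
    = (?a \<cdot> (\<theta> \<boxtimes> Ident C ?m)) \<cdot> (Ident C ?s \<boxtimes> (?a \<cdot> (\<theta> \<boxtimes> Ident C ?m))) \<cdot> Assoc C ?s ?s ?m"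
  proof -
    \<comment> \<open>Multiplicativity of \<theta> trades \<open>Mult S\<close> for
      \<open>Mult R\<close> preceded by two copies of \<theta>, exposing the associativity law of
      the \<open>R\<close>-action.\<close>
    have "(?a \<cdot> (\<theta> \<boxtimes> Ident C ?m)) \<cdot> (Mult S \<boxtimes> Ident C ?m)
      = (?a \<cdot> (Mult R \<boxtimes> Ident C ?m)) \<cdot> ((\<theta> \<boxtimes> \<theta>) \<boxtimes> Ident C ?m)"
      by (simp add: map_Mult)
    also have "\<dots> = ?a \<cdot> (Ident C ?r \<boxtimes> ?a) \<cdot> (Assoc C ?r ?r ?m \<cdot> ((\<theta> \<boxtimes> \<theta>) \<boxtimes> Ident C ?m))"
      unfolding S.is_module_Act(1)[OF M] by simp
    \<comment> \<open>Naturality moves both copies of \<theta> past the associator, so that each is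
      absorbed into one of the two restricted actions.\<close>
    also have "Assoc C ?r ?r ?m \<cdot> ((\<theta> \<boxtimes> \<theta>) \<boxtimes> Ident C ?m) = (\<theta> \<boxtimes> \<theta> \<boxtimes> Ident C ?m) \<cdot> Assoc C ?s ?s ?m"
      using S.Assoc_natural_Arr[of \<theta> \<theta> "Ident C ?m"] by simp
    finally show ?thesis by simp
  qed
  have "(?a \<cdot> (\<theta> \<boxtimes> Ident C ?m)) \<cdot> (MonUnit S \<boxtimes> Ident C ?m) = LUnit C ?m"
    using S.is_module_Act(2)[OF M] by (simp add: map_MonUnit)
  with assoc show ?thesis
    by (simp add: restriction_def functor_on_modules_def is_module_def Hom_def)
qed

text \<open>\<theta> acts on the scalar factor and \<open>f\<close> on the module factor, so the two
  commute by interchange.\<close>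

lemma is_module_map_restriction:
  assumes M: "is_module C R M" and N: "is_module C R N" and f: "is_module_map C R M N f"
  shows "is_module_map C S (onObj (restriction C \<theta>) M) (onObj (restriction C \<theta>) N) f"
proof -
  note [simp] = S.MonObj_in_Obj R.MonObj_in_Obj S.is_module_ObjD[OF M] S.is_module_Arr[OF M]
    S.is_module_ObjD[OF N] S.is_module_Arr[OF N] S.is_module_map_Arr[OF f]
  have "f \<cdot> (Act M \<cdot> (\<theta> \<boxtimes> Ident C (ModObj M))) = (f \<cdot> Act M) \<cdot> (\<theta> \<boxtimes> Ident C (ModObj M))"
    by simp
  also have "\<dots> = (Act N \<cdot> (\<theta> \<boxtimes> Ident C (ModObj N))) \<cdot> (Ident C (MonObj S) \<boxtimes> f)"
    unfolding S.is_module_map_Act[OF f] by simp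
  finally show ?thesis
    by (simp add: restriction_def functor_on_modules_def is_module_map_def Hom_def)
qed

lemma functor_between_restriction: "functor_between (Mod C R) (Mod C S) (restriction C \<theta>)"
proof -
  \<comment> \<open>Restriction leaves underlying arrows unchanged, so it lies over
    \<open>id_functor\<close>.\<close>
  have "functor_between (Mod C R) (Mod C S)
    (functor_on_modules (onObj (restriction C \<theta>)) (onArr (id_functor :: ('o, 'm, 'o, 'm) functor_data)))"
  proof (rule functor_between_functor_on_modules)
    show "functor_between C C id_functor" by (rule S.functor_between_id)
    show "category (Mod C R)" "category (Mod C S)"
      by (simp_all add: S.category_Mod S.MonObj_in_Obj R.MonObj_in_Obj)
  qed (simp_all add: is_module_restriction is_module_map_restriction id_functor_def,
      simp add: restriction_def functor_on_modules_def)
  then show ?thesis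
    by (simp add: restriction_def functor_on_modules_def id_functor_def)
qed

end


section \<open>The left adjoint on modules\<close>

context strong_symmetric_monoidal_functor
begin

lemma MuF_Arr [simp]:
  assumes "X \<in> Obj C" "Y \<in> Obj C"
  shows "MuF F X Y \<in> Arr D" "Dom D (MuF F X Y) = onObj F X \<otimes>\<^bsub>D\<^esub> onObj F Y"
    "Cod D (MuF F X Y) = onObj F (X \<otimes>\<^bsub>C\<^esub> Y)"
  using MuF_in_Hom[OF assms] by (auto simp: Hom_def)

lemma UnitF_Arr [simp]:
  "UnitF F \<in> Arr D" "Dom D (UnitF F) = UnitObj D" "Cod D (UnitF F) = onObj F (UnitObj C)"
  using UnitF_in_Hom by (auto simp: Hom_def)

text \<open>Oriented so that tensors in \<open>C\<close> become tensors in \<open>D\<close>, where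
  interchange can merge them. The domains are separate premises so that any \<open>X\<close> and
  \<open>Y\<close> match.\<close>

lemma MuF_natural_Arr [simp]:
  "f \<in> Arr C \<Longrightarrow> g \<in> Arr C \<Longrightarrow> Dom C f = X \<Longrightarrow> Dom C g = Y \<Longrightarrow>
   onArr F (f \<boxtimes>\<^bsub>C\<^esub> g) \<cdot>\<^bsub>D\<^esub> MuF F X Y
     = MuF F (Cod C f) (Cod C g) \<cdot>\<^bsub>D\<^esub> (onArr F f \<boxtimes>\<^bsub>D\<^esub> onArr F g)"
  by (rule MuF_natural[symmetric]) (auto simp: Hom_def)

lemma MuF_natural_Comp [simp]:
  assumes "f \<in> Arr C" "g \<in> Arr C" "Dom C f = X" "Dom C g = Y"
    and "k \<in> Arr D" "Cod D k = onObj F X \<otimes>\<^bsub>D\<^esub> onObj F Y"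
  shows "onArr F (f \<boxtimes>\<^bsub>C\<^esub> g) \<cdot>\<^bsub>D\<^esub> (MuF F X Y \<cdot>\<^bsub>D\<^esub> k)
     = MuF F (Cod C f) (Cod C g) \<cdot>\<^bsub>D\<^esub> ((onArr F f \<boxtimes>\<^bsub>D\<^esub> onArr F g) \<cdot>\<^bsub>D\<^esub> k)"
  using assms by (subst D.Comp_reassoc[OF MuF_natural_Arr]) auto

lemma MonObj_image_monoid [simp]: "MonObj (image_monoid D F S) = onObj F (MonObj S)"
  by (simp add: image_monoid_def)

end

locale monoid_and_strong_functor =
  strong_symmetric_monoidal_functor C D F + S: monoid_object C S
  for C :: "('o1, 'm1, 'x) symmetric_monoidal_data_scheme"
    and D :: "('o2, 'm2, 'y) symmetric_monoidal_data_scheme"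
    and F :: "('o1, 'm1, 'o2, 'm2, 'z) monoidal_functor_data_scheme"
    and S :: "('o1, 'm1) monoid_data"
begin

declare S.MonObj_in_Obj [simp]

lemma Mult_Arr [simp]:
  "Mult S \<in> Arr C" "Dom C (Mult S) = MonObj S \<otimes>\<^bsub>C\<^esub> MonObj S" "Cod C (Mult S) = MonObj S"
  using S.Mult_in_Hom by (auto simp: Hom_def)

lemma MonUnit_Arr [simp]:
  "MonUnit S \<in> Arr C" "Dom C (MonUnit S) = UnitObj C" "Cod C (MonUnit S) = MonObj S"
  using S.MonUnit_in_Hom by (auto simp: Hom_def)

lemma category_Mod_image_monoid: "category (Mod D (image_monoid D F S))"
  by (rule D.category_Mod) simp

text \<open>The laws are the images under \<open>F\<close> of those of \<open>M\<close>, with the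
  bracketing corrected by \<open>MuF_assoc\<close> and the unit by \<open>MuF_LUnit\<close>.\<close>

lemma is_module_left:
  assumes M: "is_module C S M"
  shows "is_module D (image_monoid D F S) (onObj (left_on_modules D F S) M)"
proof -
  note [simp] = C.is_module_ObjD[OF M] C.is_module_Arr[OF M]
  let ?s = "MonObj S" and ?m = "ModObj M" and ?a = "Act M"
  let ?I = "\<lambda>X. Ident D (onObj F X)"
  let ?b = "onArr F ?a \<cdot>\<^bsub>D\<^esub> MuF F ?s ?m"
  \<comment> \<open>Naturality of \<open>MuF\<close> at \<open>Mult S\<close> and an identity
    gathers \<open>Act M\<close> and \<open>Mult S\<close> under a single \<open>F\<close>, so that
    the associativity law of \<open>M\<close> applies in \<open>C\<close>.\<close>
  have "?b \<cdot>\<^bsub>D\<^esub> ((onArr F (Mult S) \<cdot>\<^bsub>D\<^esub> MuF F ?s ?s) \<boxtimes>\<^bsub>D\<^esub> ?I ?m)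
    = onArr F (?a \<cdot>\<^bsub>C\<^esub> (Mult S \<boxtimes>\<^bsub>C\<^esub> Ident C ?m)) \<cdot>\<^bsub>D\<^esub> MuF F (?s \<otimes>\<^bsub>C\<^esub> ?s) ?m \<cdot>\<^bsub>D\<^esub> (MuF F ?s ?s \<boxtimes>\<^bsub>D\<^esub> ?I ?m)"
    by simp
  also have "\<dots> = onArr F ?a \<cdot>\<^bsub>D\<^esub> onArr F (Ident C ?s \<boxtimes>\<^bsub>C\<^esub> ?a) \<cdot>\<^bsub>D\<^esub>
      (onArr F (Assoc C ?s ?s ?m) \<cdot>\<^bsub>D\<^esub> MuF F (?s \<otimes>\<^bsub>C\<^esub> ?s) ?m \<cdot>\<^bsub>D\<^esub> (MuF F ?s ?s \<boxtimes>\<^bsub>D\<^esub> ?I ?m))"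
    unfolding C.is_module_Act(1)[OF M] by simp
  \<comment> \<open>\<open>MuF_assoc\<close> produces the associator of \<open>D\<close> and two
    copies of \<open>MuF\<close>, one for each occurrence of \<open>?b\<close>.\<close>
  also have "\<dots> = ?b \<cdot>\<^bsub>D\<^esub> (?I ?s \<boxtimes>\<^bsub>D\<^esub> ?b) \<cdot>\<^bsub>D\<^esub> Assoc D (onObj F ?s) (onObj F ?s) (onObj F ?m)"
    by (subst MuF_assoc) simp_all
  finally have assoc: "?b \<cdot>\<^bsub>D\<^esub> ((onArr F (Mult S) \<cdot>\<^bsub>D\<^esub> MuF F ?s ?s) \<boxtimes>\<^bsub>D\<^esub> ?I ?m)
    = ?b \<cdot>\<^bsub>D\<^esub> (?I ?s \<boxtimes>\<^bsub>D\<^esub> ?b) \<cdot>\<^bsub>D\<^esub> Assoc D (onObj F ?s) (onObj F ?s) (onObj F ?m)" .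
  have "?b \<cdot>\<^bsub>D\<^esub> ((onArr F (MonUnit S) \<cdot>\<^bsub>D\<^esub> UnitF F) \<boxtimes>\<^bsub>D\<^esub> ?I ?m)
    = onArr F (?a \<cdot>\<^bsub>C\<^esub> (MonUnit S \<boxtimes>\<^bsub>C\<^esub> Ident C ?m)) \<cdot>\<^bsub>D\<^esub> MuF F (UnitObj C) ?m \<cdot>\<^bsub>D\<^esub> (UnitF F \<boxtimes>\<^bsub>D\<^esub> ?I ?m)"
    by simp
  also have "\<dots> = LUnit D (onObj F ?m)"
    unfolding C.is_module_Act(2)[OF M] by (rule MuF_LUnit) simp
  finally show ?thesis
    using assoc
    by (simp add: is_module_def left_on_modules_def functor_on_modules_def image_monoid_def Hom_def)
qed

text \<open>The square is \<open>F\<close> of the square for \<open>f\<close>, combined with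
  naturality of \<open>MuF\<close> at an identity and \<open>f\<close>.\<close>

lemma is_module_map_left:
  assumes M: "is_module C S M" and N: "is_module C S N" and f: "is_module_map C S M N f"
  shows "is_module_map D (image_monoid D F S)
    (onObj (left_on_modules D F S) M) (onObj (left_on_modules D F S) N) (onArr F f)"
proof -
  note [simp] = C.is_module_ObjD[OF M] C.is_module_Arr[OF M]
    C.is_module_ObjD[OF N] C.is_module_Arr[OF N] C.is_module_map_Arr[OF f]
  have "onArr F f \<cdot>\<^bsub>D\<^esub> (onArr F (Act M) \<cdot>\<^bsub>D\<^esub> MuF F (MonObj S) (ModObj M))
    = onArr F (f \<cdot>\<^bsub>C\<^esub> Act M) \<cdot>\<^bsub>D\<^esub> MuF F (MonObj S) (ModObj M)"
    by simp
  also have "\<dots> = (onArr F (Act N) \<cdot>\<^bsub>D\<^esub> MuF F (MonObj S) (ModObj N))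
      \<cdot>\<^bsub>D\<^esub> (Ident D (onObj F (MonObj S)) \<boxtimes>\<^bsub>D\<^esub> onArr F f)"
    unfolding C.is_module_map_Act[OF f] by simp
  finally show ?thesis
    by (simp add: is_module_map_def left_on_modules_def functor_on_modules_def Hom_def)
qed

lemma functor_between_left:
  "functor_between (Mod C S) (Mod D (image_monoid D F S)) (left_on_modules D F S)"
proof -
  have "functor_between (Mod C S) (Mod D (image_monoid D F S))
    (functor_on_modules (onObj (left_on_modules D F S)) (onArr F))"
  proof (rule functor_between_functor_on_modules)
    show "functor_between C D F" by unfold_locales
    show "category (Mod C S)" by (simp add: C.category_Mod)
  qed (simp_all add: is_module_left is_module_map_left category_Mod_image_monoid,
      simp add: left_on_modules_def functor_on_modules_def)
  then show ?thesis
    by (simp add: left_on_modules_def functor_on_modules_def)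
qed

end


section \<open>The right adjoint on modules\<close>

context strong_monoidal_adjunction
begin

lemma unit_Arr [simp]:
  assumes "X \<in> Obj C"
  shows "\<eta> X \<in> Arr C" "Dom C (\<eta> X) = X" "Cod C (\<eta> X) = onObj U (onObj F X)"
  using unit.component_Arr[OF assms] by (simp_all add: id_functor_def comp_functor_def)

lemma counit_Arr [simp]:
  assumes "Y \<in> Obj D"
  shows "\<epsilon> Y \<in> Arr D" "Dom D (\<epsilon> Y) = onObj F (onObj U Y)" "Cod D (\<epsilon> Y) = Y"
  using counit.component_Arr[OF assms] by (simp_all add: id_functor_def comp_functor_def)

lemma unit_natural:
  "f \<in> Arr C \<Longrightarrow> \<eta> (Cod C f) \<cdot>\<^bsub>C\<^esub> f = onArr U (onArr F f) \<cdot>\<^bsub>C\<^esub> \<eta> (Dom C f)"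
  using unit.naturality[of f "Dom C f" "Cod C f"]
  by (simp add: id_functor_def comp_functor_def Hom_def)

text \<open>Moving \<epsilon> to the right strips \<open>F\<close> and \<open>U\<close> from
  \<open>onArr F (onArr U f)\<close>. Together with the triangle identity this turns transposes of
  maps built from \<open>U\<close> and \<eta> into composites in \<open>D\<close>.\<close>

lemma counit_natural [simp]:
  "f \<in> Arr D \<Longrightarrow> Cod D f = Y \<Longrightarrow> \<epsilon> Y \<cdot>\<^bsub>D\<^esub> onArr F (onArr U f) = f \<cdot>\<^bsub>D\<^esub> \<epsilon> (Dom D f)"
  using counit.naturality[of f "Dom D f" "Cod D f"]
  by (simp add: id_functor_def comp_functor_def Hom_def)

lemma counit_natural_Comp [simp]:
  assumes "f \<in> Arr D" "Cod D f = Y" "k \<in> Arr D" "Cod D k = onObj F (onObj U (Dom D f))"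
  shows "\<epsilon> Y \<cdot>\<^bsub>D\<^esub> (onArr F (onArr U f) \<cdot>\<^bsub>D\<^esub> k) = f \<cdot>\<^bsub>D\<^esub> (\<epsilon> (Dom D f) \<cdot>\<^bsub>D\<^esub> k)"
  using assms by (subst D.Comp_reassoc[OF counit_natural]) auto

declare triangle_left [simp]

lemma triangle_left_Comp [simp]:
  assumes "X \<in> Obj C" "k \<in> Arr D" "Cod D k = onObj F X"
  shows "\<epsilon> (onObj F X) \<cdot>\<^bsub>D\<^esub> (onArr F (\<eta> X) \<cdot>\<^bsub>D\<^esub> k) = k"
  using assms by (subst D.Comp_reassoc[OF triangle_left]) auto

section \<open>Transposition along the adjunction\<close>

lemma transpose_inject:
  assumes f: "f \<in> Arr C" "Cod C f = onObj U Y" and g: "g \<in> Arr C" "Cod C g = onObj U Y"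
    and "Y \<in> Obj D" "Dom C f = Dom C g" and eq: "\<epsilon> Y \<cdot>\<^bsub>D\<^esub> onArr F f = \<epsilon> Y \<cdot>\<^bsub>D\<^esub> onArr F g"
  shows "f = g"
proof -
  \<comment> \<open>Any \<open>h\<close> into \<open>onObj U Y\<close> is recovered from its
    transpose: insert the second triangle identity after \<open>h\<close>, then move
    \<open>h\<close> past \<eta> by naturality.\<close>
  have *: "h = onArr U (\<epsilon> Y \<cdot>\<^bsub>D\<^esub> onArr F h) \<cdot>\<^bsub>C\<^esub> \<eta> (Dom C h)"
    if h: "h \<in> Arr C" "Cod C h = onObj U Y" for h
  proof -
    have "h = (onArr U (\<epsilon> Y) \<cdot>\<^bsub>C\<^esub> \<eta> (onObj U Y)) \<cdot>\<^bsub>C\<^esub> h"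
      using h \<open>Y \<in> Obj D\<close> by (subst triangle_right) simp_all
    also have "\<dots> = onArr U (\<epsilon> Y) \<cdot>\<^bsub>C\<^esub> (\<eta> (Cod C h) \<cdot>\<^bsub>C\<^esub> h)"
      using h \<open>Y \<in> Obj D\<close> by simp
    also have "\<dots> = onArr U (\<epsilon> Y \<cdot>\<^bsub>D\<^esub> onArr F h) \<cdot>\<^bsub>C\<^esub> \<eta> (Dom C h)"
      unfolding unit_natural[OF h(1)] using h \<open>Y \<in> Obj D\<close> by simp
    finally show ?thesis .
  qed
  show ?thesis
    using *[OF f] *[OF g] eq assms(6) by simp
qed

text \<open>Since \<open>MuF\<close> is invertible, transposes may be compared after precomposition
  with it. They then start at a tensor product in \<open>D\<close>, where
  \<open>transpose_induced\<close> and the coherence axioms apply.\<close>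

lemma transpose_MuF_inject:
  assumes "f \<in> Arr C" "Cod C f = onObj U Y" "Dom C f = X \<otimes>\<^bsub>C\<^esub> Z"
    and "g \<in> Arr C" "Cod C g = onObj U Y" "Dom C g = X \<otimes>\<^bsub>C\<^esub> Z"
    and "X \<in> Obj C" "Z \<in> Obj C" "Y \<in> Obj D"
    and "\<epsilon> Y \<cdot>\<^bsub>D\<^esub> onArr F f \<cdot>\<^bsub>D\<^esub> MuF F X Z = \<epsilon> Y \<cdot>\<^bsub>D\<^esub> onArr F g \<cdot>\<^bsub>D\<^esub> MuF F X Z"
  shows "f = g"
proof (rule transpose_inject)
  show "\<epsilon> Y \<cdot>\<^bsub>D\<^esub> onArr F f = \<epsilon> Y \<cdot>\<^bsub>D\<^esub> onArr F g"
    by (rule D.iso_cancel_right[OF MuF_iso[of X Z]]) (use assms in simp_all)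
qed (use assms in simp_all)

text \<open>For \<open>h = Act N\<close> this is the action on \<open>U N\<close>. Allowing any
  \<open>h\<close> out of \<open>F X \<otimes> N\<close> separates the transposition argument from
  the module laws.\<close>

definition induced :: "'o1 \<Rightarrow> 'o2 \<Rightarrow> 'm2 \<Rightarrow> 'm1" where
  "induced X N h = onArr U h \<cdot>\<^bsub>C\<^esub> laxU C D F U \<eta> \<epsilon> (onObj F X) N
     \<cdot>\<^bsub>C\<^esub> (\<eta> X \<boxtimes>\<^bsub>C\<^esub> Ident C (onObj U N))"

lemma inverse_MuF [simp]:
  assumes "X \<in> Obj C" "Y \<in> Obj C"
  shows "inverse_arrow D (MuF F X Y) \<in> Arr D"
    "Dom D (inverse_arrow D (MuF F X Y)) = onObj F (X \<otimes>\<^bsub>C\<^esub> Y)"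
    "Cod D (inverse_arrow D (MuF F X Y)) = onObj F X \<otimes>\<^bsub>D\<^esub> onObj F Y"
    "inverse_arrow D (MuF F X Y) \<cdot>\<^bsub>D\<^esub> MuF F X Y = Ident D (onObj F X \<otimes>\<^bsub>D\<^esub> onObj F Y)"
  using D.inverse_arrows_inverse_arrow[OF MuF_iso[OF assms]] assms
  by (auto simp: inverse_arrows_def Hom_def)

lemma inverse_MuF_Comp [simp]:
  assumes "X \<in> Obj C" "Y \<in> Obj C" "k \<in> Arr D" "Cod D k = onObj F X \<otimes>\<^bsub>D\<^esub> onObj F Y"
  shows "inverse_arrow D (MuF F X Y) \<cdot>\<^bsub>D\<^esub> (MuF F X Y \<cdot>\<^bsub>D\<^esub> k) = k"
  using assms by (subst D.Comp_reassoc[OF inverse_MuF(4)]) auto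

lemma induced_Arr [simp]:
  assumes "X \<in> Obj C" "N \<in> Obj D" "h \<in> Arr D" "Dom D h = onObj F X \<otimes>\<^bsub>D\<^esub> N"
  shows "induced X N h \<in> Arr C" "Dom C (induced X N h) = X \<otimes>\<^bsub>C\<^esub> onObj U N"
    "Cod C (induced X N h) = onObj U (Cod D h)"
  using assms by (simp_all add: induced_def laxU_def)

text \<open>Naturality of \<epsilon> brings out \<open>h\<close>, the tensor of counits and the
  inverse of \<open>MuF\<close>; naturality of \<open>MuF\<close> moves \<open>\<eta> X\<close> to
  the right. The left triangle identity removes the outer \<eta>, the inverse cancels against
  \<open>MuF\<close>, and the same identity at \<open>X\<close> leaves
  \<open>Ident D (onObj F X)\<close> in the first factor.\<close>

lemma transpose_induced [simp]:
  assumes "X \<in> Obj C" "N \<in> Obj D" "h \<in> Arr D" "Dom D h = onObj F X \<otimes>\<^bsub>D\<^esub> N" "Cod D h = Y"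
  shows "\<epsilon> Y \<cdot>\<^bsub>D\<^esub> (onArr F (induced X N h) \<cdot>\<^bsub>D\<^esub> MuF F X (onObj U N))
    = h \<cdot>\<^bsub>D\<^esub> (Ident D (onObj F X) \<boxtimes>\<^bsub>D\<^esub> \<epsilon> N)"
  using assms by (simp add: induced_def laxU_def)

lemma transpose_induced_Comp [simp]:
  assumes "X \<in> Obj C" "N \<in> Obj D" "h \<in> Arr D" "Dom D h = onObj F X \<otimes>\<^bsub>D\<^esub> N" "Cod D h = Y"
    and "k \<in> Arr D" "Cod D k = onObj F X \<otimes>\<^bsub>D\<^esub> onObj F (onObj U N)"
  shows "\<epsilon> Y \<cdot>\<^bsub>D\<^esub> (onArr F (induced X N h) \<cdot>\<^bsub>D\<^esub> (MuF F X (onObj U N) \<cdot>\<^bsub>D\<^esub> k))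
    = h \<cdot>\<^bsub>D\<^esub> ((Ident D (onObj F X) \<boxtimes>\<^bsub>D\<^esub> \<epsilon> N) \<cdot>\<^bsub>D\<^esub> k)"
proof -
  have "\<epsilon> Y \<cdot>\<^bsub>D\<^esub> (onArr F (induced X N h) \<cdot>\<^bsub>D\<^esub> (MuF F X (onObj U N) \<cdot>\<^bsub>D\<^esub> k))
    = (\<epsilon> Y \<cdot>\<^bsub>D\<^esub> (onArr F (induced X N h) \<cdot>\<^bsub>D\<^esub> MuF F X (onObj U N))) \<cdot>\<^bsub>D\<^esub> k"
    using assms by (auto simp del: transpose_induced)
  also have "\<dots> = h \<cdot>\<^bsub>D\<^esub> ((Ident D (onObj F X) \<boxtimes>\<^bsub>D\<^esub> \<epsilon> N) \<cdot>\<^bsub>D\<^esub> k)"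
    using assms by (subst transpose_induced) auto
  finally show ?thesis .
qed

text \<open>After transposition and precomposition with \<open>MuF\<close>, both sides are
  \<open>h \<cdot> (onArr F t \<boxtimes> \<epsilon> N)\<close>. With \<open>t = \<theta>\<close>
  and \<open>h = Act N\<close> this equates the two restricted actions on
  \<open>U N\<close>.\<close>

lemma induced_restrict:
  assumes "t \<in> Arr C" "N \<in> Obj D" "h \<in> Arr D" "Dom D h = onObj F (Cod C t) \<otimes>\<^bsub>D\<^esub> N"
  shows "induced (Cod C t) N h \<cdot>\<^bsub>C\<^esub> (t \<boxtimes>\<^bsub>C\<^esub> Ident C (onObj U N))
    = induced (Dom C t) N (h \<cdot>\<^bsub>D\<^esub> (onArr F t \<boxtimes>\<^bsub>D\<^esub> Ident D N))"
  by (rule transpose_MuF_inject[where Y = "Cod D h" and X = "Dom C t" and Z = "onObj U N"])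
    (use assms in simp_all)

text \<open>After transposition and precomposition with \<open>MuF\<close>, the sides are
  \<open>f \<cdot> h \<cdot> (1 \<boxtimes> \<epsilon> N)\<close> and
  \<open>h' \<cdot> (1 \<boxtimes> (f \<cdot> \<epsilon> N))\<close>, which the intertwining
  hypothesis on \<open>f\<close> identifies.\<close>

lemma onArr_U_induced:
  assumes "X \<in> Obj C" "N \<in> Obj D" "N' \<in> Obj D" and "h \<in> Arr D" "Dom D h = onObj F X \<otimes>\<^bsub>D\<^esub> N" "Cod D h = N"
    and "h' \<in> Arr D" "Dom D h' = onObj F X \<otimes>\<^bsub>D\<^esub> N'" "Cod D h' = N'"
    and "f \<in> Arr D" "Dom D f = N" "Cod D f = N'"
    and "f \<cdot>\<^bsub>D\<^esub> h = h' \<cdot>\<^bsub>D\<^esub> (Ident D (onObj F X) \<boxtimes>\<^bsub>D\<^esub> f)"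
  shows "onArr U f \<cdot>\<^bsub>C\<^esub> induced X N h = induced X N' h' \<cdot>\<^bsub>C\<^esub> (Ident C X \<boxtimes>\<^bsub>C\<^esub> onArr U f)"
proof (rule transpose_MuF_inject[where Y = N' and X = X and Z = "onObj U N"])
  have "f \<cdot>\<^bsub>D\<^esub> (h \<cdot>\<^bsub>D\<^esub> (Ident D (onObj F X) \<boxtimes>\<^bsub>D\<^esub> \<epsilon> N))
    = h' \<cdot>\<^bsub>D\<^esub> (Ident D (onObj F X) \<boxtimes>\<^bsub>D\<^esub> (f \<cdot>\<^bsub>D\<^esub> \<epsilon> N))"
    using assms by (subst D.Comp_reassoc[OF assms(13)]) auto
  then show "\<epsilon> N' \<cdot>\<^bsub>D\<^esub> onArr F (onArr U f \<cdot>\<^bsub>C\<^esub> induced X N h) \<cdot>\<^bsub>D\<^esub> MuF F X (onObj U N)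
    = \<epsilon> N' \<cdot>\<^bsub>D\<^esub> onArr F (induced X N' h' \<cdot>\<^bsub>C\<^esub> (Ident C X \<boxtimes>\<^bsub>C\<^esub> onArr U f)) \<cdot>\<^bsub>D\<^esub> MuF F X (onObj U N)"
    using assms by simp
qed (use assms in simp_all)

lemma onObj_right_on_modules:
  "onObj (right_on_modules C D F U \<eta> \<epsilon> S) N
    = \<lparr>ModObj = onObj U (ModObj N), Act = induced (MonObj S) (ModObj N) (Act N)\<rparr>"
  by (simp add: right_on_modules_def functor_on_modules_def induced_def)

end

section \<open>Module structures carried by the right adjoint\<close>

locale monoid_and_strong_adjunction =
  strong_monoidal_adjunction C D F U \<eta> \<epsilon> + monoid_and_strong_functor C D F S
  for C :: "('o1, 'm1, 'x) symmetric_monoidal_data_scheme"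
    and D :: "('o2, 'm2, 'y) symmetric_monoidal_data_scheme"
    and F :: "('o1, 'm1, 'o2, 'm2, 'z) monoidal_functor_data_scheme"
    and U :: "('o2, 'm2, 'o1, 'm1, 'w) functor_data_scheme"
    and \<eta> :: "'o1 \<Rightarrow> 'm1"
    and \<epsilon> :: "'o2 \<Rightarrow> 'm2"
    and S :: "('o1, 'm1) monoid_data"
begin

lemma is_module_right:
  assumes N: "is_module D (image_monoid D F S) N"
  shows "is_module C S (onObj (right_on_modules C D F U \<eta> \<epsilon> S) N)"
proof -
  let ?s = "MonObj S" and ?n = "ModObj N" and ?h = "Act N" and ?u = "onObj U (ModObj N)"
  let ?fs = "onObj F ?s" and ?fu = "onObj F ?u"
  let ?a = "induced ?s ?n ?h"
  note [simp] = D.is_module_ObjD[OF N]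
  have [simp]: "?h \<in> Arr D" "Dom D ?h = ?fs \<otimes>\<^bsub>D\<^esub> ?n" "Cod D ?h = ?n"
    using D.is_module_Arr[OF N] by simp_all
  let ?m = "onArr F (Mult S) \<cdot>\<^bsub>D\<^esub> MuF F ?s ?s" and ?e = "onArr F (MonUnit S) \<cdot>\<^bsub>D\<^esub> UnitF F"
  have act: "?h \<cdot>\<^bsub>D\<^esub> (?m \<boxtimes>\<^bsub>D\<^esub> Ident D ?n) = ?h \<cdot>\<^bsub>D\<^esub> (Ident D ?fs \<boxtimes>\<^bsub>D\<^esub> ?h) \<cdot>\<^bsub>D\<^esub> Assoc D ?fs ?fs ?n"
    and unit: "?h \<cdot>\<^bsub>D\<^esub> (?e \<boxtimes>\<^bsub>D\<^esub> Ident D ?n) = LUnit D ?n"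
    using D.is_module_Act[OF N] by (simp_all add: image_monoid_def)
  have assoc: "?a \<cdot>\<^bsub>C\<^esub> (Mult S \<boxtimes>\<^bsub>C\<^esub> Ident C ?u) = ?a \<cdot>\<^bsub>C\<^esub> (Ident C ?s \<boxtimes>\<^bsub>C\<^esub> ?a) \<cdot>\<^bsub>C\<^esub> Assoc C ?s ?s ?u"
    (is "?l = ?r")
  proof (rule transpose_MuF_inject[where Y = ?n and X = "?s \<otimes>\<^bsub>C\<^esub> ?s" and Z = ?u])
    let ?M = "MuF F (?s \<otimes>\<^bsub>C\<^esub> ?s) ?u" and ?K = "MuF F ?s ?s \<boxtimes>\<^bsub>D\<^esub> Ident D ?fu"
    show "\<epsilon> ?n \<cdot>\<^bsub>D\<^esub> onArr F ?l \<cdot>\<^bsub>D\<^esub> ?M = \<epsilon> ?n \<cdot>\<^bsub>D\<^esub> onArr F ?r \<cdot>\<^bsub>D\<^esub> ?M"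
    \<comment> \<open>Precomposition with the further isomorphism \<open>?K\<close> completes the
      left side of \<open>MuF_assoc\<close>, and on the other side joins
      \<open>onArr F (Mult S)\<close> to form the multiplication \<open>?m\<close>.\<close>
    proof (rule D.iso_cancel_right[where m = ?K])
      show "is_iso D ?K"
        by (simp add: D.is_iso_TensorArr MuF_iso D.is_iso_Ident)
      \<comment> \<open>The left side becomes
        \<open>?h \<cdot> (?m \<boxtimes> \<epsilon> ?n)\<close>, split so that \<open>act\<close>
        applies. The identity on the first factor is written as a tensor product to match naturality
        of the associator.\<close>
      have "(\<epsilon> ?n \<cdot>\<^bsub>D\<^esub> onArr F ?l \<cdot>\<^bsub>D\<^esub> ?M) \<cdot>\<^bsub>D\<^esub> ?K
        = (?h \<cdot>\<^bsub>D\<^esub> (?m \<boxtimes>\<^bsub>D\<^esub> Ident D ?n)) \<cdot>\<^bsub>D\<^esub> ((Ident D ?fs \<boxtimes>\<^bsub>D\<^esub> Ident D ?fs) \<boxtimes>\<^bsub>D\<^esub> \<epsilon> ?n)"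
        by simp
      also have "\<dots> = ?h \<cdot>\<^bsub>D\<^esub> (Ident D ?fs \<boxtimes>\<^bsub>D\<^esub> ?h) \<cdot>\<^bsub>D\<^esub>
          (Assoc D ?fs ?fs ?n \<cdot>\<^bsub>D\<^esub> ((Ident D ?fs \<boxtimes>\<^bsub>D\<^esub> Ident D ?fs) \<boxtimes>\<^bsub>D\<^esub> \<epsilon> ?n))"
        unfolding act by simp
      also have "\<dots> = ?h \<cdot>\<^bsub>D\<^esub> (Ident D ?fs \<boxtimes>\<^bsub>D\<^esub> ?h) \<cdot>\<^bsub>D\<^esub>
          ((Ident D ?fs \<boxtimes>\<^bsub>D\<^esub> Ident D ?fs \<boxtimes>\<^bsub>D\<^esub> \<epsilon> ?n) \<cdot>\<^bsub>D\<^esub> Assoc D ?fs ?fs ?fu)"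
        using D.Assoc_natural_Arr[of "Ident D ?fs" "Ident D ?fs" "\<epsilon> ?n"] by simp
      \<comment> \<open>\<open>transpose_induced\<close>, read backwards for the outer action and
        again inside the second tensor factor, reintroduces both copies of
        \<open>?a\<close>.\<close>
      also have "\<dots> = \<epsilon> ?n \<cdot>\<^bsub>D\<^esub> onArr F ?a \<cdot>\<^bsub>D\<^esub> onArr F (Ident C ?s \<boxtimes>\<^bsub>C\<^esub> ?a) \<cdot>\<^bsub>D\<^esub>
          (MuF F ?s (?s \<otimes>\<^bsub>C\<^esub> ?u) \<cdot>\<^bsub>D\<^esub> (Ident D ?fs \<boxtimes>\<^bsub>D\<^esub> MuF F ?s ?u) \<cdot>\<^bsub>D\<^esub> Assoc D ?fs ?fs ?fu)"
        by simp
      also have "\<dots> = (\<epsilon> ?n \<cdot>\<^bsub>D\<^esub> onArr F ?r \<cdot>\<^bsub>D\<^esub> ?M) \<cdot>\<^bsub>D\<^esub> ?K"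
        by (subst MuF_assoc[symmetric]) simp_all
      finally show "(\<epsilon> ?n \<cdot>\<^bsub>D\<^esub> onArr F ?l \<cdot>\<^bsub>D\<^esub> ?M) \<cdot>\<^bsub>D\<^esub> ?K = (\<epsilon> ?n \<cdot>\<^bsub>D\<^esub> onArr F ?r \<cdot>\<^bsub>D\<^esub> ?M) \<cdot>\<^bsub>D\<^esub> ?K" .
    qed simp_all
  qed simp_all
  have "?a \<cdot>\<^bsub>C\<^esub> (MonUnit S \<boxtimes>\<^bsub>C\<^esub> Ident C ?u) = LUnit C ?u" (is "?l = ?r")
  proof (rule transpose_MuF_inject[where Y = ?n and X = "UnitObj C" and Z = ?u])
    let ?M = "MuF F (UnitObj C) ?u" and ?K = "UnitF F \<boxtimes>\<^bsub>D\<^esub> Ident D ?fu"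
    show "\<epsilon> ?n \<cdot>\<^bsub>D\<^esub> onArr F ?l \<cdot>\<^bsub>D\<^esub> ?M = \<epsilon> ?n \<cdot>\<^bsub>D\<^esub> onArr F ?r \<cdot>\<^bsub>D\<^esub> ?M"
    \<comment> \<open>Here \<open>?K\<close> completes the left side of \<open>MuF_LUnit\<close>,
      and on the other side joins \<open>onArr F (MonUnit S)\<close> to form the unit
      \<open>?e\<close>.\<close>
    proof (rule D.iso_cancel_right[where m = ?K])
      show "is_iso D ?K"
        by (simp add: D.is_iso_TensorArr UnitF_iso D.is_iso_Ident)
      have "(\<epsilon> ?n \<cdot>\<^bsub>D\<^esub> onArr F ?l \<cdot>\<^bsub>D\<^esub> ?M) \<cdot>\<^bsub>D\<^esub> ?K
        = (?h \<cdot>\<^bsub>D\<^esub> (?e \<boxtimes>\<^bsub>D\<^esub> Ident D ?n)) \<cdot>\<^bsub>D\<^esub> (Ident D (UnitObj D) \<boxtimes>\<^bsub>D\<^esub> \<epsilon> ?n)"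
        by simp
      also have "\<dots> = \<epsilon> ?n \<cdot>\<^bsub>D\<^esub> LUnit D ?fu"
        unfolding unit using D.LUnit_natural_Arr[of "\<epsilon> ?n"] by simp
      also have "\<dots> = (\<epsilon> ?n \<cdot>\<^bsub>D\<^esub> onArr F ?r \<cdot>\<^bsub>D\<^esub> ?M) \<cdot>\<^bsub>D\<^esub> ?K"
        by (subst MuF_LUnit[symmetric]) simp_all
      finally show "(\<epsilon> ?n \<cdot>\<^bsub>D\<^esub> onArr F ?l \<cdot>\<^bsub>D\<^esub> ?M) \<cdot>\<^bsub>D\<^esub> ?K = (\<epsilon> ?n \<cdot>\<^bsub>D\<^esub> onArr F ?r \<cdot>\<^bsub>D\<^esub> ?M) \<cdot>\<^bsub>D\<^esub> ?K" .
    qed simp_all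
  qed simp_all
  with assoc show ?thesis
    by (simp add: is_module_def onObj_right_on_modules Hom_def)
qed

lemma is_module_map_right:
  assumes M: "is_module D (image_monoid D F S) M" and N: "is_module D (image_monoid D F S) N"
    and f: "is_module_map D (image_monoid D F S) M N f"
  shows "is_module_map C S (onObj (right_on_modules C D F U \<eta> \<epsilon> S) M)
    (onObj (right_on_modules C D F U \<eta> \<epsilon> S) N) (onArr U f)"
  using D.is_module_ObjD[OF M] D.is_module_ObjD[OF N] D.is_module_Arr[OF M] D.is_module_Arr[OF N]
    D.is_module_map_Arr[OF f] D.is_module_map_Act[OF f]
  by (simp add: is_module_map_def onObj_right_on_modules Hom_def onArr_U_induced)

lemma functor_between_right:
  "functor_between (Mod D (image_monoid D F S)) (Mod C S) (right_on_modules C D F U \<eta> \<epsilon> S)"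
proof -
  have "functor_between (Mod D (image_monoid D F S)) (Mod C S)
    (functor_on_modules (onObj (right_on_modules C D F U \<eta> \<epsilon> S)) (onArr U))"
  proof (rule functor_between_functor_on_modules)
    show "functor_between D C U" by unfold_locales
    show "category (Mod C S)" by (simp add: C.category_Mod)
  qed (simp_all add: is_module_right is_module_map_right category_Mod_image_monoid,
      simp add: onObj_right_on_modules)
  then show ?thesis
    by (simp add: right_on_modules_def functor_on_modules_def)
qed

end


section \<open>Comparison of the composites with restriction of scalars\<close>

theorem proposition4p5:
  fixes C :: "('o1, 'm1) symmetric_monoidal_data"
    and D :: "('o2, 'm2) symmetric_monoidal_data"
    and F :: "('o1, 'm1, 'o2, 'm2) monoidal_functor_data"
    and U :: "('o2, 'm2, 'o1, 'm1) functor_data"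
    and \<eta> :: "'o1 \<Rightarrow> 'm1" and \<epsilon> :: "'o2 \<Rightarrow> 'm2"
    and S R :: "('o1, 'm1) monoid_data"
    and \<theta> :: 'm1 and \<phi> :: 'm2
  assumes adj: "strong_monoidal_adjunction C D F U \<eta> \<epsilon>"
    and theta: "monoid_map C S R \<theta>"
    and phi: "\<phi> = onArr F \<theta>"
  shows "naturally_isomorphic (Mod D (image_monoid D F R)) (Mod C S)
           (restriction C \<theta> \<circ>\<^sub>F right_on_modules C D F U \<eta> \<epsilon> R)
           (right_on_modules C D F U \<eta> \<epsilon> S \<circ>\<^sub>F restriction D \<phi>)
       \<and> naturally_isomorphic (Mod C R) (Mod D (image_monoid D F S))
           (left_on_modules D F S \<circ>\<^sub>F restriction C \<theta>)
           (restriction D \<phi> \<circ>\<^sub>F left_on_modules D F R)"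
proof -
  interpret strong_monoidal_adjunction C D F U \<eta> \<epsilon> by (rule adj)
  interpret \<theta>: monoid_map C S R \<theta> by (rule theta)
  interpret S: monoid_and_strong_adjunction C D F U \<eta> \<epsilon> S by unfold_locales
  interpret R: monoid_and_strong_adjunction C D F U \<eta> \<epsilon> R by unfold_locales
  let ?U = "right_on_modules C D F U \<eta> \<epsilon>" and ?F = "left_on_modules D F"
  have "naturally_isomorphic (Mod D (image_monoid D F R)) (Mod C S)
      (restriction C \<theta> \<circ>\<^sub>F ?U R) (?U S \<circ>\<^sub>F restriction D \<phi>)"
  proof (rule functor_between.naturally_isomorphic_if_equal)
    show "functor_between (Mod D (image_monoid D F R)) (Mod C S) (restriction C \<theta> \<circ>\<^sub>F ?U R)"
      by (rule functor_between_comp[OF R.functor_between_right \<theta>.functor_between_restriction])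
    have obj: "onObj (?U S) (onObj (restriction D \<phi>) N) = onObj (restriction C \<theta>) (onObj (?U R) N)"
      if N: "is_module D (image_monoid D F R) N" for N
      using induced_restrict[of \<theta> "ModObj N" "Act N"] D.is_module_ObjD[OF N] D.is_module_Arr[OF N]
      by (simp add: restriction_def functor_on_modules_def onObj_right_on_modules phi)
    then show "onObj (?U S \<circ>\<^sub>F restriction D \<phi>) N = onObj (restriction C \<theta> \<circ>\<^sub>F ?U R) N"
      if "N \<in> Obj (Mod D (image_monoid D F R))" for N
      using that by (simp add: Mod_def comp_functor_def)
    \<comment> \<open>Module arrows record source and target, so the object equation is used at both
      ends; the underlying arrow is \<open>onArr U (Und f)\<close> on either side.\<close>
    show "onArr (?U S \<circ>\<^sub>F restriction D \<phi>) f = onArr (restriction C \<theta> \<circ>\<^sub>F ?U R) f"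
      if "f \<in> Arr (Mod D (image_monoid D F R))" for f
      using that obj[of "Src f"] obj[of "Trg f"]
      by (simp add: Mod_def comp_functor_def restriction_def right_on_modules_def functor_on_modules_def)
  qed
  moreover have "naturally_isomorphic (Mod C R) (Mod D (image_monoid D F S))
      (?F S \<circ>\<^sub>F restriction C \<theta>) (restriction D \<phi> \<circ>\<^sub>F ?F R)"
  proof (rule functor_between.naturally_isomorphic_if_equal)
    show "functor_between (Mod C R) (Mod D (image_monoid D F S)) (?F S \<circ>\<^sub>F restriction C \<theta>)"
      by (rule functor_between_comp[OF \<theta>.functor_between_restriction S.functor_between_left])
    \<comment> \<open>Naturality of \<open>MuF\<close> at \<theta> and an identity turns
      \<open>F\<close> of the restricted action into the action on \<open>F M\<close> restricted
      along \<open>onArr F \<theta>\<close>.\<close>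
    have obj: "onObj (restriction D \<phi>) (onObj (?F R) M) = onObj (?F S) (onObj (restriction C \<theta>) M)"
      if M: "is_module C R M" for M
      using C.is_module_ObjD[OF M] C.is_module_Arr[OF M]
      by (simp add: restriction_def functor_on_modules_def left_on_modules_def phi)
    then show "onObj (restriction D \<phi> \<circ>\<^sub>F ?F R) M = onObj (?F S \<circ>\<^sub>F restriction C \<theta>) M"
      if "M \<in> Obj (Mod C R)" for M
      using that by (simp add: Mod_def comp_functor_def)
    show "onArr (restriction D \<phi> \<circ>\<^sub>F ?F R) f = onArr (?F S \<circ>\<^sub>F restriction C \<theta>) f"
      if "f \<in> Arr (Mod C R)" for f
      using that obj[of "Src f"] obj[of "Trg f"]
      by (simp add: Mod_def comp_functor_def restriction_def left_on_modules_def functor_on_modules_def)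
  qed
  ultimately show ?thesis ..
qed

end
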